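(* Let $a<b$ be real numbers, let $\nu:[a,b]\to[0,\infty)$ be continuous and positive, and let $w:[a,b]\to\mathbb{R}$ be differentiable with $w'(t)=\nu(t)$ on $[a,b]$. Let $f:[a,b]\to\mathbb{R}$ be differentiable with $M=\sup_{a<t<b}|f'(t)|<\infty$, let $\psi:[0,1]\to[0,1]$ be a function, and let $\lambda\in[0,1]$. For $s,t\in[a,b]$ put $$K(s,t)=\begin{cases} w(s)-\left(w(a)+\psi(\lambda)\frac{w(b)-w(a)}{2}\right), & s\in[a,t),\\[2pt] w(s)-\left(w(a)+(1+\psi(1-\lambda))\frac{w(b)-w(a)}{2}\right), & s\in[t,b].\end{cases}$$ Then $$\begin{aligned} &\Bigg|\frac{1+\psi(1-\lambda)-\psi(\lambda)}{4}\big(f^2(b)-f^2(a)\big)-\frac{f(b)-f(a)}{\int_a^b\nu(t)\,dt}\int_a^b\nu(s)f(s)\,ds\\ &\quad+\frac{\psi(\lambda)f(a)+(1-\psi(1-\lambda))f(b)}{2}\big(f(b)-f(a)\big)\Bigg|\\ &\le\frac{M^2}{\int_a^b\nu(t)\,dt}\int_a^b\left(\int_a^b|K(s,t)|\,ds\right)dt . \end{aligned}$$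
   Context: Here $f^2(t)$ means $(f(t))^2$, and $[a,b]$ is an ordinary real interval. *)

theory Defs
  imports "HOL-Analysis.Analysis"
begin

text \<open>
  The kernel is only meant for \<open>s, t\<close> in \<open>[a, b]\<close>; there the test \<open>s < t\<close> selects
  \<open>s \<in> [a, t)\<close> and its negation selects \<open>s \<in> [t, b]\<close>.
\<close>

definition montgomery_kernel :: "real \<Rightarrow> real \<Rightarrow> (real \<Rightarrow> real) \<Rightarrow> (real \<Rightarrow> real) \<Rightarrow> real \<Rightarrow> real \<Rightarrow> real \<Rightarrow> real"
  where "montgomery_kernel a b w \<psi> \<mu> s t =
    (if s < t
     then w s - (w a + \<psi> \<mu> * ((w b - w a) / 2))
     else w s - (w a + (1 + \<psi> (1 - \<mu>)) * ((w b - w a) / 2)))"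

end

theory Submission imports Defs begin

text \<open>
  Integrating by parts on both sides of \<open>t\<close> gives a Montgomery identity: \<open>\<integral> K(s,t) f'(s) ds\<close> is
  \<open>\<integral> \<nu>\<close> times a fixed affine function of \<open>f t\<close>, minus \<open>\<integral> \<nu> f\<close>. Multiplying it by \<open>f'(t)\<close> and
  integrating over \<open>t\<close> turns it into \<open>\<integral> \<nu>\<close> times the expression to be estimated, while
  \<open>\<bar>f'\<bar> \<le> M\<close> bounds the result by \<open>M\<^sup>2\<close> times the double integral of \<open>\<bar>K\<bar>\<close>. The derivative of \<open>f\<close>
  need not be continuous, so the gauge integral is used throughout.
\<close>

lemma has_integral_piecewise:
  fixes g h :: "real \<Rightarrow> real"
  assumes "t \<in> {a..b}" "(g has_integral I) {a..t}" "(h has_integral J) {t..b}"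
  shows "((\<lambda>s. if s < t then g s else h s) has_integral (I + J)) {a..b}"
proof (rule has_integral_combine[of a t b])
  \<comment> \<open>The test already fails at \<open>s = t\<close>, so on \<open>{a..t}\<close> the
    integrand may differ from \<open>g\<close> at that single point.\<close>
  show "((\<lambda>s. if s < t then g s else h s) has_integral I) {a..t}"
    by (rule has_integral_spike_finite[OF _ _ assms(2), of "{t}"]) auto
  show "((\<lambda>s. if s < t then g s else h s) has_integral J) {t..b}"
    by (rule has_integral_eq[OF _ assms(3)]) auto
qed (use assms(1) in auto)

text \<open>The product rule makes \<open>(w s - c) * f s\<close> an antiderivative of
  \<open>(w s - c) * f' s + \<nu> s * f s\<close>, and the continuous second summand can be
  subtracted. The shift \<open>c\<close> leaves the derivative of \<open>w\<close> unchanged, so the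
  lemma serves both branches of the kernel.\<close>

lemma has_integral_by_parts_shifted:
  fixes w f \<nu> f' :: "real \<Rightarrow> real"
  assumes "x \<le> y" "continuous_on {x..y} w" "continuous_on {x..y} f" "continuous_on {x..y} \<nu>"
    and w': "\<And>s. s \<in> {x<..<y} \<Longrightarrow> (w has_real_derivative \<nu> s) (at s)"
    and f': "\<And>s. s \<in> {x<..<y} \<Longrightarrow> (f has_real_derivative f' s) (at s)"
  shows "((\<lambda>s. (w s - c) * f' s) has_integral
    ((w y - c) * f y - (w x - c) * f x - integral {x..y} (\<lambda>s. \<nu> s * f s))) {x..y}"
proof -
  have "((\<lambda>s. (w s - c) * f' s + \<nu> s * f s) has_integral
      ((w y - c) * f y - (w x - c) * f x)) {x..y}"
    using assms(1-3)
    by (intro fundamental_theorem_of_calculus_interior continuous_intros)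
      (auto simp flip: has_real_derivative_iff_has_vector_derivative
        intro!: derivative_eq_intros w' f')
  moreover have "((\<lambda>s. \<nu> s * f s) has_integral integral {x..y} (\<lambda>s. \<nu> s * f s)) {x..y}"
    using assms(3,4)
    by (intro integrable_integral integrable_continuous_interval continuous_intros)
  ultimately have "((\<lambda>s. (w s - c) * f' s + \<nu> s * f s - \<nu> s * f s) has_integral
      ((w y - c) * f y - (w x - c) * f x - integral {x..y} (\<lambda>s. \<nu> s * f s))) {x..y}"
    by (rule has_integral_diff)
  then show ?thesis
    by simp
qed

lemma abs_has_integral_le:
  fixes g h :: "real \<Rightarrow> real"
  assumes "(g has_integral I) S" "(h has_integral J) S" "\<And>x. x \<in> S \<Longrightarrow> \<bar>g x\<bar> \<le> h x"
  shows "\<bar>I\<bar> \<le> J"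
  using integral_norm_bound_integral[of g S h] assms
  by (auto simp: integral_unique has_integral_integrable)

theorem corollary14:
  fixes a b M \<mu> :: real and \<nu> w f \<psi> :: "real \<Rightarrow> real"
  assumes "a < b"
    and "continuous_on {a..b} \<nu>"
    and "\<And>t. t \<in> {a..b} \<Longrightarrow> 0 < \<nu> t"
    and "\<And>t. t \<in> {a..b} \<Longrightarrow> (w has_real_derivative \<nu> t) (at t within {a..b})"
    and "f differentiable_on {a..b}"
    and "bdd_above ((\<lambda>t. \<bar>deriv f t\<bar>) ` {a<..<b})"
    and "M = (SUP t\<in>{a<..<b}. \<bar>deriv f t\<bar>)"
    and "\<psi> \<in> {0..1} \<rightarrow> {0..1}"
    and "\<mu> \<in> {0..1}"
  shows
    "\<bar>(1 + \<psi> (1 - \<mu>) - \<psi> \<mu>) / 4 * ((f b)\<^sup>2 - (f a)\<^sup>2)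
          - (f b - f a) / integral {a..b} \<nu> * integral {a..b} (\<lambda>s. \<nu> s * f s)
          + (\<psi> \<mu> * f a + (1 - \<psi> (1 - \<mu>)) * f b) / 2 * (f b - f a)\<bar>
         \<le> M\<^sup>2 / integral {a..b} \<nu>
            * integral {a..b} (\<lambda>t. integral {a..b} (\<lambda>s. \<bar>montgomery_kernel a b w \<psi> \<mu> s t\<bar>))"
proof -
  define p q where "p = \<psi> \<mu>" and "q = \<psi> (1 - \<mu>)"
  define W where "W = w b - w a"
  define c d where "c = w a + p * (W / 2)" and "d = w a + (1 + q) * (W / 2)"
  define N where "N = integral {a..b} (\<lambda>s. \<nu> s * f s)"
  let ?K = "montgomery_kernel a b w \<psi> \<mu>"
  let ?H = "\<lambda>t. integral {a..b} (\<lambda>s. \<bar>?K s t\<bar>)"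
  \<comment> \<open>No bound is assumed on \<open>deriv f\<close> at the endpoints, where it may be a junk value.\<close>
  define g where "g t = (if t \<in> {a<..<b} then deriv f t else 0)" for t
  note ab = assms(1) and cont_\<nu> = assms(2)
  have K_eq: "?K s t = (if s < t then w s - c else w s - d)" for s t
    by (simp add: montgomery_kernel_def c_def d_def p_def q_def W_def)

  have cont_w: "continuous_on {a..b} w"
    using assms(4) DERIV_continuous_on by blast
  have cont_f: "continuous_on {a..b} f"
    using assms(5) differentiable_imp_continuous_on by blast
  have w': "(w has_real_derivative \<nu> t) (at t)" if "t \<in> {a<..<b}" for t
    using assms(4)[of t] that by (auto simp: at_within_Icc_at)
  have f': "(f has_real_derivative g t) (at t)" if "t \<in> {a<..<b}" for t
  proof -
    have "f differentiable (at t)"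
      using assms(5) that by (auto simp: differentiable_on_def at_within_Icc_at dest!: bspec[of _ _ t])
    then show ?thesis
      using that by (simp add: g_def DERIV_deriv_iff_real_differentiable)
  qed
  have le_M: "\<bar>deriv f t\<bar> \<le> M" if "t \<in> {a<..<b}" for t
    unfolding assms(7) using assms(6) that by (intro cSUP_upper)
  \<comment> \<open>Any interior point shows \<open>0 \<le> M\<close>; this extends the bound to the
    points where \<open>g\<close> is set to 0.\<close>
  have "\<bar>deriv f ((a + b) / 2)\<bar> \<le> M"
    using ab by (intro le_M) auto
  then have M: "0 \<le> M" by linarith
  then have g_le: "\<bar>g t\<bar> \<le> M" for t
    using le_M by (simp add: g_def)

  have int_\<nu>: "integral {a..b} \<nu> = W"
    unfolding W_def using ab assms(4)
    by (intro integral_unique fundamental_theorem_of_calculus)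
      (auto simp flip: has_real_derivative_iff_has_vector_derivative)
  \<comment> \<open>Strict monotonicity makes \<open>W\<close>, the integral of
    \<open>\<nu>\<close>, positive, so that it can be divided by at the end.\<close>
  have "w a < w b"
  proof (rule DERIV_pos_imp_increasing_open[OF ab _ cont_w])
    show "\<exists>y. (w has_real_derivative y) (at t) \<and> 0 < y" if "a < t" "t < b" for t
      using w'[of t] assms(3)[of t] that by (intro exI[of _ "\<nu> t"]) auto
  qed
  then have W_pos: "0 < W"
    by (simp add: W_def)

  have montgomery: "((\<lambda>s. ?K s t * g s) has_integral
      (W * ((1 + q - p) / 2 * f t + (p * f a + (1 - q) * f b) / 2) - N)) {a..b}"
    if t: "t \<in> {a..b}" for t
  proof -
    have cont: "continuous_on {a..t} h" "continuous_on {t..b} h"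
      if "continuous_on {a..b} h" for h :: "real \<Rightarrow> real"
      using t that by (auto intro: continuous_on_subset)
    let ?I = "(w t - c) * f t - (w a - c) * f a - integral {a..t} (\<lambda>s. \<nu> s * f s)"
    let ?J = "(w b - d) * f b - (w t - d) * f t - integral {t..b} (\<lambda>s. \<nu> s * f s)"
    have "((\<lambda>s. if s < t then (w s - c) * g s else (w s - d) * g s) has_integral (?I + ?J)) {a..b}"
      using t by (intro has_integral_piecewise has_integral_by_parts_shifted
          cont[OF cont_w] cont[OF cont_f] cont[OF cont_\<nu>] w' f') auto
    moreover have "(\<lambda>s. ?K s t * g s) = (\<lambda>s. if s < t then (w s - c) * g s else (w s - d) * g s)"
      by (auto simp: K_eq)
    moreover have "integral {a..t} (\<lambda>s. \<nu> s * f s) + integral {t..b} (\<lambda>s. \<nu> s * f s) = N"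
      unfolding N_def using t cont_f cont_\<nu>
      by (intro Henstock_Kurzweil_Integration.integral_combine integrable_continuous_interval
          continuous_intros) auto
    then have "?I + ?J = (w t - c) * f t - (w a - c) * f a + ((w b - d) * f b - (w t - d) * f t) - N"
      by linarith
    \<comment> \<open>The terms in \<open>w t\<close> cancel: the coefficient of \<open>f t\<close>
      is \<open>d - c = W * (1 + q - p) / 2\<close>. At the ends, \<open>c - w a = W * p / 2\<close>
      and \<open>w b - d = W * (1 - q) / 2\<close>.\<close>
    moreover have "\<dots> = W * ((1 + q - p) / 2 * f t + (p * f a + (1 - q) * f b) / 2) - N"
      by (simp add: c_def d_def W_def field_simps)
    ultimately show ?thesis
      by simp
  qed

  have int_w: "(\<lambda>s. \<bar>w s - e\<bar>) integrable_on {a..b}" for e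
    using cont_w by (intro integrable_continuous_interval continuous_intros)
  \<comment> \<open>Splitting at \<open>t\<close> leaves \<open>t\<close> only in the limits of
    integration. Hence \<open>?H\<close> is continuous although the kernel jumps at
    \<open>s = t\<close>, and the outer integral exists.\<close>
  have H: "((\<lambda>s. \<bar>?K s t\<bar>) has_integral
      (integral {a..t} (\<lambda>s. \<bar>w s - c\<bar>) + integral {t..b} (\<lambda>s. \<bar>w s - d\<bar>))) {a..b}"
    if t: "t \<in> {a..b}" for t
  proof -
    have "((\<lambda>s. if s < t then \<bar>w s - c\<bar> else \<bar>w s - d\<bar>) has_integral
      (integral {a..t} (\<lambda>s. \<bar>w s - c\<bar>) + integral {t..b} (\<lambda>s. \<bar>w s - d\<bar>))) {a..b}"
      using t by (intro has_integral_piecewise integrable_integral integrable_subinterval_real[OF int_w]) auto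
    then show ?thesis
      by (simp add: K_eq if_distrib)
  qed
  have "continuous_on {a..b}
      (\<lambda>t. integral {a..t} (\<lambda>s. \<bar>w s - c\<bar>) + integral {t..b} (\<lambda>s. \<bar>w s - d\<bar>))"
    by (intro continuous_intros indefinite_integral_continuous_1 indefinite_integral_continuous_1' int_w)
  then have "continuous_on {a..b} ?H"
    by (rule continuous_on_eq) (simp add: integral_unique[OF H])
  then have int_H: "?H integrable_on {a..b}"
    by (rule integrable_continuous_interval)

  \<comment> \<open>The value in \<open>montgomery\<close> is \<open>A * f t + B\<close>. Its
    product with \<open>g t\<close> has the antiderivative
    \<open>A / 2 * (f t)\<^sup>2 + B * f t\<close>, the source of the squares in the claim.\<close>
  define A B where "A = W * (1 + q - p) / 2" and "B = W * (p * f a + (1 - q) * f b) / 2 - N"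
  have inner: "\<bar>A * f t + B\<bar> \<le> M * ?H t" if t: "t \<in> {a..b}" for t
  proof (rule abs_has_integral_le)
    show "((\<lambda>s. ?K s t * g s) has_integral (A * f t + B)) {a..b}"
      using montgomery[OF t] by (simp add: A_def B_def field_simps)
    show "((\<lambda>s. M * \<bar>?K s t\<bar>) has_integral M * ?H t) {a..b}"
      using H[OF t] by (intro has_integral_mult_right integrable_integral) blast
    show "\<bar>?K s t * g s\<bar> \<le> M * \<bar>?K s t\<bar>" for s
      using mult_left_mono[OF g_le[of s], of "\<bar>?K s t\<bar>"] by (simp add: abs_mult mult.commute)
  qed
  have "\<bar>(A / 2 * (f b)\<^sup>2 + B * f b) - (A / 2 * (f a)\<^sup>2 + B * f a)\<bar> \<le> M\<^sup>2 * integral {a..b} ?H"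
  proof (rule abs_has_integral_le)
    show "((\<lambda>t. (A * f t + B) * g t) has_integral
        ((A / 2 * (f b)\<^sup>2 + B * f b) - (A / 2 * (f a)\<^sup>2 + B * f a))) {a..b}"
      using ab cont_f
      by (intro fundamental_theorem_of_calculus_interior continuous_intros)
        (auto simp flip: has_real_derivative_iff_has_vector_derivative
          intro!: derivative_eq_intros f' simp: algebra_simps)
    show "((\<lambda>t. M\<^sup>2 * ?H t) has_integral M\<^sup>2 * integral {a..b} ?H) {a..b}"
      using int_H by (intro has_integral_mult_right integrable_integral)
    show "\<bar>(A * f t + B) * g t\<bar> \<le> M\<^sup>2 * ?H t" if "t \<in> {a..b}" for t
      \<comment> \<open>The second use of \<open>inner\<close> supplies
        \<open>0 \<le> M * ?H t\<close>, a side condition of \<open>mult_mono\<close>.\<close>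
      using mult_mono[OF inner[OF that] g_le[of t]] inner[OF that] M
      by (auto simp: abs_mult power2_eq_square mult_ac)
  qed
  then have "\<bar>(A / 2 * (f b)\<^sup>2 + B * f b) - (A / 2 * (f a)\<^sup>2 + B * f a)\<bar> / W
      \<le> M\<^sup>2 / W * integral {a..b} ?H"
    using W_pos by (simp add: divide_right_mono)
  also have "\<bar>(A / 2 * (f b)\<^sup>2 + B * f b) - (A / 2 * (f a)\<^sup>2 + B * f a)\<bar> / W =
      \<bar>((A / 2 * (f b)\<^sup>2 + B * f b) - (A / 2 * (f a)\<^sup>2 + B * f a)) / W\<bar>"
    using W_pos by simp
  \<comment> \<open>Here \<open>A / (2 * W) = (1 + q - p) / 4\<close> and
    \<open>B / W = (p * f a + (1 - q) * f b) / 2 - N / W\<close>.\<close>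
  also have "((A / 2 * (f b)\<^sup>2 + B * f b) - (A / 2 * (f a)\<^sup>2 + B * f a)) / W =
      (1 + q - p) / 4 * ((f b)\<^sup>2 - (f a)\<^sup>2) - (f b - f a) / W * N
        + (p * f a + (1 - q) * f b) / 2 * (f b - f a)"
    using W_pos by (simp add: A_def B_def field_simps)
  finally show ?thesis
    unfolding int_\<nu> p_def q_def N_def .
qed

end
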